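(* For every $Q>0$, $$\mathbb{T}^2=\bigsqcup_{\substack{r\in\mathcal{O}\text{ monic}\\ |r|\le q^Q}}\ \ \bigsqcup_{\substack{d\mid r,\ d\text{ monic},\ \underline{c}=(c_1,c_2)\in\mathcal{O}^2\text{ primitive}\\ |r|q^{-Q/2}\le |d\underline{c}|\le |r|^{1/2}\\ |dc_2|<|r|^{1/2}}}\ \ \bigsqcup_{\substack{\underline{a}\in\mathcal{O}^2,\ |\underline{a}|<|r|\\ \gcd(\underline{a},r)=1\\ \underline{a}/r\in L(d\underline{c})}} D(\underline{a},r,Q),$$ that is, the sets $D(\underline{a},r,Q)$, indexed by all quadruples $(r,d,\underline{c},\underline{a})$ satisfying the displayed conditions, are pairwise disjoint and their union is $\mathbb{T}^2$.
   Context: Let $q$ be an odd prime power, $K=\mathbb{F}_q(t)$, $\mathcal{O}=\mathbb{F}_q[t]$, and let $|\cdot|$ be the absolute value with $|a/b|=q^{\deg a-\deg b}$; $K_\infty=\mathbb{F}_q((1/t))$ is the completion of $K$ for $|\cdot|$, and $\mathbb{T}=\{x\in K_\infty:|x|<1\}$. For $\underline{x}=(x_1,x_2)\in K_\infty^2$ put $|\underline{x}|=\max\{|x_1|,|x_2|\}$. For $\underline{a}=(a_1,a_2)\in\mathcal{O}^2$, $\gcd(\underline{a},r)=\gcd(a_1,a_2,r)$. A vector $\underline{c}=(c_1,c_2)\in\mathcal{O}^2$ is called primitive if $\gcd(c_1,c_2)=1$ and either $c_1$ is monic, or $c_1=0$ and $c_2$ is monic. For nonzero $d\in\mathcal{O}$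 and primitive $\underline{c}$, let $L_1(d\underline{c},k)=\{\underline{x}\in K_\infty^2: d\,\underline{c}\cdot\underline{x}=k\}$ for $k\in\mathcal{O}$, and define the generalised line $$L(d\underline{c})=\{\underline{a}/r\in\mathbb{T}^2\cap L_1(d\underline{c},k)\text{ for some }k\in\mathcal{O}:\ \gcd(a_1,a_2,r)=\gcd(d,k)=1\},$$ where $\underline{a}\in\mathcal{O}^2$ and $0\ne r\in\mathcal{O}$. For $\underline{a}\in\mathcal{O}^2$, $0\neq r\in\mathcal{O}$ and $Q>0$, $D(\underline{a},r,Q)=\{\underline{\xi}\in\mathbb{T}^2:|\underline{\xi}-\underline{a}/r|<|r|^{-1}q^{-Q/2}\}$. *)

theory Defs
  imports
    Complex_Main
    "HOL-Library.Cardinality"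
    "HOL-Library.Disjoint_Sets"
    "HOL-Library.Product_Plus"
    "HOL-Computational_Algebra.Computational_Algebra"
begin

text \<open>
  Throughout, the type \<open>'a :: {field, finite}\<close> is the finite field with \<open>q = CARD('a)\<close> elements,
  \<open>'a poly\<close> is the polynomial ring in \<open>t\<close>, and \<open>'a fls\<close> is the field of formal Laurent series in
  \<open>1/t\<close>. So the variable \<open>fls_X\<close> of \<open>'a fls\<close> stands for \<open>1/t\<close>, and \<open>fls_X_inv\<close> for \<open>t\<close>.
\<close>

definition emb :: "'a::{field, finite} poly \<Rightarrow> 'a fls" where
  "emb p = poly (map_poly fls_const p) fls_X_inv"

text \<open>
  The subdegree is the order of vanishing in \<open>1/t\<close>, so that a polynomial of degree \<open>n\<close> has
  absolute value \<open>q\<^sup>n\<close>; see \<open>absval_emb_divide\<close> below. This is not the distance from \<open>0\<close> in the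
  library metric on \<open>'a fls\<close>, which uses base \<open>2\<close>.
\<close>

definition absval :: "'a::{field, finite} fls \<Rightarrow> real" where
  "absval x = (if x = 0 then 0 else real CARD('a) powi (- fls_subdegree x))"

definition vabsval :: "'a::{field, finite} fls \<times> 'a fls \<Rightarrow> real" where
  "vabsval x = max (absval (fst x)) (absval (snd x))"

definition vemb :: "'a::{field, finite} poly \<times> 'a poly \<Rightarrow> 'a fls \<times> 'a fls" where
  "vemb a = (emb (fst a), emb (snd a))"

definition unit_ball :: "'a::{field, finite} fls set" where
  "unit_ball = {x. absval x < 1}"

definition frac_pt :: "'a::{field, finite} poly \<times> 'a poly \<Rightarrow> 'a poly \<Rightarrow> 'a fls \<times> 'a fls" where
  "frac_pt a r = (emb (fst a) / emb r, emb (snd a) / emb r)"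

text \<open>
  The condition \<open>gcd(a\<^sub>1, a\<^sub>2, r) = 1\<close>, in the style of the library's \<^const>\<open>coprime\<close>: this needs
  no choice of a normalised gcd, hence no further class constraint on the coefficient field.
\<close>

definition coprime3 :: "'a::{field, finite} poly \<times> 'a poly \<Rightarrow> 'a poly \<Rightarrow> bool" where
  "coprime3 a r \<longleftrightarrow> (\<forall>e. e dvd fst a \<longrightarrow> e dvd snd a \<longrightarrow> e dvd r \<longrightarrow> is_unit e)"

definition monic :: "'a::{field, finite} poly \<Rightarrow> bool" where
  "monic p \<longleftrightarrow> lead_coeff p = 1"

definition primitive_vec :: "'a::{field, finite} poly \<times> 'a poly \<Rightarrow> bool" where
  "primitive_vec c \<longleftrightarrow>
     coprime (fst c) (snd c) \<and> (monic (fst c) \<or> fst c = 0 \<and> monic (snd c))"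

definition smul :: "'a::{field, finite} poly \<Rightarrow> 'a poly \<times> 'a poly \<Rightarrow> 'a poly \<times> 'a poly" where
  "smul d c = (d * fst c, d * snd c)"

definition line_level ::
  "'a::{field, finite} poly \<Rightarrow> 'a poly \<times> 'a poly \<Rightarrow> 'a poly \<Rightarrow> ('a fls \<times> 'a fls) set" where
  "line_level d c k =
     {x. emb d * (emb (fst c) * fst x + emb (snd c) * snd x) = emb k}"

definition gen_line ::
  "'a::{field, finite} poly \<Rightarrow> 'a poly \<times> 'a poly \<Rightarrow> ('a fls \<times> 'a fls) set" where
  "gen_line d c =
     {frac_pt a r | a r k. r \<noteq> 0 \<and> frac_pt a r \<in> (unit_ball \<times> unit_ball) \<inter> line_level d c k
        \<and> coprime3 a r \<and> coprime d k}"

definition farey_box ::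
  "'a::{field, finite} poly \<times> 'a poly \<Rightarrow> 'a poly \<Rightarrow> real \<Rightarrow> ('a fls \<times> 'a fls) set" where
  "farey_box a r Q =
     {\<xi> \<in> unit_ball \<times> unit_ball.
        vabsval (\<xi> - frac_pt a r) < inverse (absval (emb r)) * real CARD('a) powr (- Q / 2)}"

definition farey_index ::
  "real \<Rightarrow> ('a::{field, finite} poly \<times> 'a poly \<times> ('a poly \<times> 'a poly) \<times> ('a poly \<times> 'a poly)) set"
  where
  "farey_index Q =
     {(r, d, c, a).
        monic r \<and> absval (emb r) \<le> real CARD('a) powr Q \<and>
        d dvd r \<and> monic d \<and> primitive_vec c \<and>
        absval (emb r) * real CARD('a) powr (- Q / 2) \<le> vabsval (vemb (smul d c)) \<and>
        vabsval (vemb (smul d c)) \<le> sqrt (absval (emb r)) \<and>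
        absval (emb (d * snd c)) < sqrt (absval (emb r)) \<and>
        vabsval (vemb a) < absval (emb r) \<and>
        coprime3 a r \<and>
        frac_pt a r \<in> gen_line d c}"

lemma emb_0 [simp]: "emb 0 = 0"
  by (simp add: emb_def)

lemma emb_pCons: "emb (pCons a p) = fls_const a + fls_X_inv * emb p"
  by (cases "a = 0 \<and> p = 0") (auto simp: emb_def map_poly_pCons)

lemma emb_1 [simp]: "emb 1 = 1"
  by (simp add: one_pCons emb_pCons)

lemma emb_t: "emb [:0, 1:] = fls_X_inv"
  by (simp add: emb_pCons)

lemma emb_add: "emb (p + q) = emb p + emb q"
  by (induction p q rule: poly_induct2) (simp_all add: emb_pCons algebra_simps fls_plus_const)

lemma emb_smult: "emb (smult a p) = fls_const a * emb p"
  by (induction p) (simp_all add: emb_pCons algebra_simps flip: fls_const_mult_const)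

lemma emb_mult: "emb (p * q) = emb p * emb q"
  by (induction p) (simp_all add: emb_pCons emb_add emb_smult algebra_simps)

lemma emb_nth: "fls_nth (emb p) n = (if n \<le> 0 then coeff p (nat (- n)) else 0)"
proof (induction p arbitrary: n)
  case (pCons a p)
  have "nat (- n) = Suc (nat (- (n + 1)))" if "n < 0"
    using that by linarith
  then show ?case
    using pCons.IH[of "n + 1"]
    by (auto simp: emb_pCons fls_X_inv_times_conv_shift)
qed simp

lemma emb_eq_0_iff [simp]: "emb p = 0 \<longleftrightarrow> p = 0"
proof
  assume "emb p = 0"
  then have "coeff p n = 0" for n
    using emb_nth[of p "- int n"] by simp
  then show "p = 0"
    by (simp add: poly_eq_iff)
qed simp

lemma fls_subdegree_emb: "fls_subdegree (emb p) = - int (degree p)"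
proof (cases "p = 0")
  case False
  then show ?thesis
    by (intro fls_subdegree_eqI) (auto simp: emb_nth coeff_eq_0)
qed simp

lemma absval_emb_divide:
  fixes a b :: "'a::{field, finite} poly"
  assumes "a \<noteq> 0" "b \<noteq> 0"
  shows "absval (emb a / emb b) = real CARD('a) powi (int (degree a) - int (degree b))"
  using assms by (simp add: absval_def fls_divide_subdegree fls_subdegree_emb)

end

theory Submission
  imports Defs
begin

text \<open>
  For a fraction \<open>a/r\<close> in lowest terms consider the dual lattice \<open>\<Lambda> = {w. r dvd w \<cdot> a}\<close>, of
  covolume \<open>\<bar>r\<bar>\<close>. The points of \<open>L(dc)\<close> are those for which \<open>dc\<close> is a primitive vector of
  \<open>\<Lambda>\<close>. A determinant argument shows that \<open>\<bar>dc\<bar> \<le> \<bar>r\<bar>\<^sup>1\<^sup>/\<^sup>2\<close> makes \<open>dc\<close> a shortest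
  nonzero vector and that the strict bound on \<open>dc\<^sub>2\<close> makes it unique; a count of coefficients shows
  that such a vector exists. Finally, rotation by a right angle maps \<open>\<Lambda>\<close> to the lattice spanned by
  \<open>a\<close> and \<open>rO\<^sup>2\<close>, and this identifies the condition \<open>\<bar>r\<bar> q^(-Q/2) \<le> \<bar>dc\<bar>\<close> with the
  minimality of \<open>\<bar>r\<bar>\<close> among the denominators whose box contains a given point.
\<close>

section \<open>Absolute values\<close>

lemma card_field_ge_2: "CARD('a::{field, finite}) \<ge> 2"
proof -
  have "card {0, 1 :: 'a} \<le> CARD('a)"
    by (intro card_mono) auto
  then show ?thesis by simp
qed

lemma card_field_gt_1: "real CARD('a::{field, finite}) > 1"
  using card_field_ge_2[where 'a='a] by linarith

lemma absval_0 [simp]: "absval 0 = 0"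
  by (simp add: absval_def)

lemma absval_nonneg [simp]: "absval (x :: 'a::{field, finite} fls) \<ge> 0"
  by (simp add: absval_def)

lemma absval_pos_iff [simp]: "absval (x :: 'a::{field, finite} fls) > 0 \<longleftrightarrow> x \<noteq> 0"
  using card_field_gt_1[where 'a='a] by (auto simp: absval_def intro: zero_less_power_int)

lemma absval_mult: "absval (x * y :: 'a::{field, finite} fls) = absval x * absval y"
proof (cases "x = 0 \<or> y = 0")
  case False
  have "real CARD('a) powi (- fls_subdegree x + - fls_subdegree y) =
      real CARD('a) powi (- fls_subdegree x) * real CARD('a) powi (- fls_subdegree y)"
    by (rule power_int_add) simp
  with False show ?thesis
    by (simp add: absval_def)
qed auto

lemma absval_minus [simp]: "absval (- x :: 'a::{field, finite} fls) = absval x"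
  by (simp add: absval_def)

lemma absval_divide: "absval (x / y :: 'a::{field, finite} fls) = absval x / absval y"
proof (cases "y = 0")
  case False
  then have "absval x = absval (x / y) * absval y"
    by (simp flip: absval_mult)
  moreover have "absval y > 0"
    using False by simp
  ultimately show ?thesis
    by (metis nonzero_mult_div_cancel_right order_less_irrefl)
qed simp

lemma absval_add_le: "absval (x + y :: 'a::{field, finite} fls) \<le> max (absval x) (absval y)"
proof (cases "x = 0 \<or> y = 0 \<or> x + y = 0")
  case True
  then show ?thesis
    by (auto simp: le_max_iff_disj)
next
  case False
  then have "min (fls_subdegree x) (fls_subdegree y) \<le> fls_subdegree (x + y)"
    by (intro fls_plus_subdegree) auto
  then have "- fls_subdegree (x + y) \<le> max (- fls_subdegree x) (- fls_subdegree y)"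
    by linarith
  then have "real CARD('a) powi (- fls_subdegree (x + y)) \<le>
      real CARD('a) powi (max (- fls_subdegree x) (- fls_subdegree y))"
    using card_field_gt_1[where 'a='a] by (intro power_int_increasing) simp_all
  also have "\<dots> \<le> max (real CARD('a) powi (- fls_subdegree x)) (real CARD('a) powi (- fls_subdegree y))"
    by (cases "- fls_subdegree x \<le> - fls_subdegree y") (simp_all only: max_def if_True if_False, simp_all)
  finally show ?thesis
    using False by (simp only: absval_def de_Morgan_disj if_False)
qed

lemma absval_diff_le: "absval (x - y :: 'a::{field, finite} fls) \<le> max (absval x) (absval y)"
  using absval_add_le[of x "- y"] by simp

text \<open>The order of vanishing is an integer while \<open>s\<close> is real: the hypothesis on
  the coefficients puts it at \<open>m + 1\<close> or higher, and \<open>- s < m + 1\<close> makes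
  the comparison of exponents strict.\<close>

lemma absval_less_powr:
  fixes x :: "'a::{field, finite} fls"
  assumes "\<And>n. n \<le> m \<Longrightarrow> fls_nth x n = 0" and "- s < of_int m + 1"
  shows "absval x < real CARD('a) powr s"
proof (cases "x = 0")
  case False
  with assms(1) have "m + 1 \<le> fls_subdegree x"
    by (intro fls_subdegree_geI) auto
  then have "real_of_int (m + 1) \<le> real_of_int (fls_subdegree x)"
    by (simp only: of_int_le_iff)
  with assms(2) have "real_of_int (- fls_subdegree x) < s"
    by simp
  with False show ?thesis
    using card_field_gt_1[where 'a='a]
    by (simp add: absval_def flip: powr_real_of_int')
qed (use card_field_gt_1[where 'a='a] in simp)

lemma emb_diff: "emb (p - s) = emb p - emb s"
  using emb_add[of "p - s" s] by (simp add: algebra_simps)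

lemma emb_minus: "emb (- p) = - emb p"
  using emb_diff[of 0 p] by simp

lemma emb_eq_iff: "emb p = emb s \<longleftrightarrow> p = s"
  using emb_eq_0_iff[of "p - s"] by (simp add: emb_diff)

lemma absval_emb: "p \<noteq> 0 \<Longrightarrow> absval (emb (p :: 'a::{field, finite} poly)) = real CARD('a) ^ degree p"
  by (simp add: absval_def fls_subdegree_emb)

lemma absval_emb_ge_1: "p \<noteq> 0 \<Longrightarrow> absval (emb (p :: 'a::{field, finite} poly)) \<ge> 1"
  using card_field_gt_1[where 'a='a] by (simp add: absval_emb)

lemma absval_emb_less_iff:
  fixes p s :: "'a::{field, finite} poly"
  shows "p \<noteq> 0 \<Longrightarrow> s \<noteq> 0 \<Longrightarrow> absval (emb p) < absval (emb s) \<longleftrightarrow> degree p < degree s"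
  by (simp only: absval_emb not_False_eq_True power_strict_increasing_iff[OF card_field_gt_1])

lemma absval_emb_le_of_dvd:
  assumes "p dvd s" "s \<noteq> 0"
  shows "absval (emb p) \<le> absval (emb (s :: 'a::{field, finite} poly))"
proof -
  have "p \<noteq> 0"
    using assms dvd_0_left by blast
  moreover have "degree p \<le> degree s"
    using assms by (rule dvd_imp_degree_le)
  ultimately show ?thesis
    using absval_emb_less_iff[OF assms(2), of p] by linarith
qed

text \<open>Discreteness of the polynomial ring, in the form that turns a small determinant
  divisible by \<open>r\<close> into a vanishing one.\<close>

lemma dvd_absval_less_imp_0:
  "p dvd s \<Longrightarrow> absval (emb s) < absval (emb p) \<Longrightarrow> s = (0 :: 'a::{field, finite} poly)"
  by (meson absval_emb_le_of_dvd not_less)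

section \<open>Coprimality of polynomials over a field\<close>

text \<open>A nonzero element of least degree in the ideal generated by \<open>a\<close>,
  \<open>b\<close>, \<open>c\<close> divides the whole ideal, since a nonzero remainder would be an
  element of smaller degree.\<close>

lemma poly_bezout3:
  fixes a b c :: "'a::field poly"
  obtains x y z where "x * a + y * b + z * c dvd a" "x * a + y * b + z * c dvd b"
    "x * a + y * b + z * c dvd c"
proof (cases "a = 0 \<and> b = 0 \<and> c = 0")
  case True
  then show ?thesis using that by simp
next
  case False
  define P where "P g \<longleftrightarrow> g \<noteq> 0 \<and> (\<exists>x y z. g = x * a + y * b + z * c)" for g
  have "a = 1 * a + 0 * b + 0 * c" "b = 0 * a + 1 * b + 0 * c" "c = 0 * a + 0 * b + 1 * c"
    by simp_all
  then have self: "\<exists>x y z. a = x * a + y * b + z * c" "\<exists>x y z. b = x * a + y * b + z * c"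
    "\<exists>x y z. c = x * a + y * b + z * c"
    by blast+
  with False have "\<exists>g. P g"
    unfolding P_def by blast
  then obtain g where g: "P g" and min: "\<And>h. P h \<Longrightarrow> degree g \<le> degree h"
    using ex_has_least_nat[of P _ degree] by blast
  from g obtain x y z where xyz: "g = x * a + y * b + z * c"
    by (auto simp: P_def)
  have dvd: "g dvd h" if "\<exists>x y z. h = x * a + y * b + z * c" for h
  proof -
    from that obtain x' y' z' where h: "h = x' * a + y' * b + z' * c" by blast
    have "h mod g = h - h div g * g"
      by (simp add: minus_div_mult_eq_mod)
    \<comment> \<open>Only the factor \<open>g\<close> is expanded; the quotient
      \<open>h div g\<close> stays intact as a coefficient.\<close>
    also have "\<dots> = (x' - h div g * x) * a + (y' - h div g * y) * b + (z' - h div g * z) * c"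
      unfolding h by (subst (2) xyz) (simp add: algebra_simps)
    finally have "h mod g \<noteq> 0 \<Longrightarrow> P (h mod g)"
      unfolding P_def by blast
    moreover have "h mod g \<noteq> 0 \<Longrightarrow> degree (h mod g) < degree g"
      using g degree_mod_less[of g h] by (auto simp: P_def)
    ultimately show ?thesis
      using min[of "h mod g"] by (metis dvd_eq_mod_eq_0 not_less)
  qed
  show ?thesis
    using dvd[OF self(1)] dvd[OF self(2)] dvd[OF self(3)] unfolding xyz by (rule that)
qed

lemma poly_bezout:
  fixes a b :: "'a::field poly"
  obtains x y where "x * a + y * b dvd a" "x * a + y * b dvd b"
  using poly_bezout3[of a b 0] by auto

lemma coprime_poly_bezout:
  fixes a b :: "'a::field poly"
  assumes "coprime a b"
  obtains x y where "x * a + y * b = 1"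
proof -
  obtain x y where xy: "x * a + y * b dvd a" "x * a + y * b dvd b"
    by (rule poly_bezout)
  then have "is_unit (x * a + y * b)"
    using assms coprime_common_divisor by blast
  then obtain u where "1 = (x * a + y * b) * u"
    by (elim dvdE)
  then have "(u * x) * a + (u * y) * b = 1"
    by (simp add: algebra_simps)
  then show ?thesis by (rule that)
qed

lemma coprime3_bezout:
  assumes "coprime3 (a, b) c"
  obtains x y z where "x * a + y * b + z * c = 1"
proof -
  obtain x y z where "x * a + y * b + z * c dvd a" "x * a + y * b + z * c dvd b"
    "x * a + y * b + z * c dvd c"
    by (rule poly_bezout3)
  then have "is_unit (x * a + y * b + z * c)"
    using assms by (auto simp: coprime3_def)
  then obtain u where "1 = (x * a + y * b + z * c) * u"
    by (elim dvdE)
  then have "(u * x) * a + (u * y) * b + (u * z) * c = 1"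
    by (simp add: algebra_simps)
  then show ?thesis by (rule that)
qed

lemma coprime_poly_dvd_mult:
  fixes a b c :: "'a::field poly"
  assumes "coprime a b" "a dvd b * c"
  shows "a dvd c"
proof -
  obtain x y where xy: "x * a + y * b = 1"
    using assms(1) by (rule coprime_poly_bezout)
  have "c = (x * a + y * b) * c"
    by (simp add: xy)
  also have "\<dots> = a * (x * c) + y * (b * c)"
    by (simp add: algebra_simps)
  finally show ?thesis
    using assms(2) by (metis dvd_add dvd_mult dvd_triv_left)
qed

text \<open>Multiply a Bezout relation for \<open>a\<close>, \<open>b\<close>, \<open>r\<close> by
  \<open>s\<close>. In other words, a fraction in lowest terms with denominator \<open>r\<close> has
  order exactly \<open>r\<close> modulo the integral points.\<close>

lemma coprime3_dvd:
  assumes "coprime3 (a, b) r" "r dvd s * a" "r dvd s * b"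
  shows "r dvd s"
proof -
  obtain x y z where xyz: "x * a + y * b + z * r = 1"
    using assms(1) by (rule coprime3_bezout)
  have "s = (x * a + y * b + z * r) * s"
    by (simp add: xyz)
  also have "\<dots> = x * (s * a) + y * (s * b) + r * (z * s)"
    by (simp add: algebra_simps)
  finally show ?thesis
    using assms(2,3) by (metis dvd_add dvd_mult dvd_triv_left)
qed

text \<open>Cancelling the gcd in its own Bezout relation leaves a relation with value 1 for the
  cofactors. Leading coefficients stay arbitrary here and are normalised later.\<close>

lemma poly_factor_out_gcd:
  fixes a b :: "'a::field poly"
  assumes "a \<noteq> 0 \<or> b \<noteq> 0"
  obtains g a' b' where "g \<noteq> 0" "a = g * a'" "b = g * b'" "coprime a' b'"
proof -
  obtain x y where xy: "x * a + y * b dvd a" "x * a + y * b dvd b"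
    by (rule poly_bezout)
  define g where "g = x * a + y * b"
  obtain a' where a': "a = g * a'"
    using xy(1) unfolding g_def by (rule dvdE)
  obtain b' where b': "b = g * b'"
    using xy(2) unfolding g_def by (rule dvdE)
  note ab = a' b'
  have g0: "g \<noteq> 0"
    using assms ab by auto
  have "g * (x * a' + y * b') = x * (g * a') + y * (g * b')"
    by (simp add: algebra_simps)
  also have "\<dots> = g * 1"
    by (simp only: ab[symmetric] g_def[symmetric] mult_1_right)
  finally have "g * (x * a' + y * b') = g * 1" .
  with g0 have "x * a' + y * b' = 1"
    by simp
  then have "coprime a' b'"
    by (intro coprimeI) (metis dvd_add dvd_mult)
  with g0 ab show ?thesis by (intro that)
qed

text \<open>The factor is \<open>x * w1 + y * w2\<close>, where \<open>x * c1 + y * c2 = 1\<close>;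
  the vanishing determinant exchanges the mixed products.\<close>

lemma coprime_parallel:
  fixes c1 c2 w1 w2 :: "'a::field poly"
  assumes "coprime c1 c2" "c1 * w2 = c2 * w1"
  obtains e where "w1 = e * c1" "w2 = e * c2"
proof -
  obtain x y where xy: "x * c1 + y * c2 = 1"
    using assms(1) by (rule coprime_poly_bezout)
  have "w1 = (x * c1 + y * c2) * w1"
    by (simp add: xy)
  also have "\<dots> = (x * w1) * c1 + y * (c2 * w1)"
    by (simp add: algebra_simps)
  also have "\<dots> = (x * w1 + y * w2) * c1"
    by (simp add: algebra_simps flip: assms(2))
  finally have w1: "w1 = (x * w1 + y * w2) * c1" .
  have "w2 = (x * c1 + y * c2) * w2"
    by (simp add: xy)
  also have "\<dots> = x * (c1 * w2) + (y * w2) * c2"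
    by (simp add: algebra_simps)
  also have "\<dots> = (x * w1 + y * w2) * c2"
    by (simp add: algebra_simps assms(2))
  finally have w2: "w2 = (x * w1 + y * w2) * c2" .
  from w1 w2 show ?thesis by (rule that)
qed

lemma monic_dvd_antisym:
  assumes "monic p" "monic s" "p dvd s" "s dvd p"
  shows "p = s"
proof -
  obtain e where e: "s = p * e"
    using assms(3) by (elim dvdE)
  have "p \<noteq> 0"
    using assms(1) by (auto simp: monic_def)
  with e assms(4) have "is_unit e"
    using dvd_mult_cancel_left[of p e 1] by simp
  then obtain c where "e = [:c:]"
    by (auto simp: is_unit_poly_iff)
  with e have s: "s = smult c p"
    by simp
  have "c = lead_coeff s"
    using assms(1) unfolding s lead_coeff_smult by (simp add: monic_def)
  also have "\<dots> = 1"
    using assms(2) by (simp add: monic_def)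
  finally show ?thesis
    by (simp add: s)
qed

section \<open>The lattice dual to a rational point\<close>

text \<open>
  By Cramer's rule the lattice \<open>{w. r dvd w\<^sub>1 a\<^sub>1 + w\<^sub>2 a\<^sub>2}\<close> has covolume at least \<open>\<bar>r\<bar>\<close>.
\<close>

lemma dual_lattice_det_dvd:
  assumes "coprime3 (a1, a2) r" "r dvd v1 * a1 + v2 * a2" "r dvd w1 * a1 + w2 * a2"
  shows "r dvd v1 * w2 - v2 * w1"
proof (rule coprime3_dvd[OF assms(1)])
  have "(v1 * w2 - v2 * w1) * a1 = w2 * (v1 * a1 + v2 * a2) - v2 * (w1 * a1 + w2 * a2)"
    by (simp add: algebra_simps)
  with assms(2,3) show "r dvd (v1 * w2 - v2 * w1) * a1"
    by simp
  have "(v1 * w2 - v2 * w1) * a2 = v1 * (w1 * a1 + w2 * a2) - w1 * (v1 * a1 + v2 * a2)"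
    by (simp add: algebra_simps)
  with assms(2,3) show "r dvd (v1 * w2 - v2 * w1) * a2"
    by simp
qed

text \<open>In the determinants below each term has one factor with a strict bound, while the other
  may attain its bound.\<close>

lemma mult_less_square:
  fixes x y M :: real
  assumes "0 \<le> y" "x \<le> M" "y < M"
  shows "x * y < M * M"
  using assms by (meson mult_right_mono mult_strict_left_mono order.strict_trans1 order.strict_trans2)

text \<open>The determinant of \<open>dc\<close> and a strictly shorter \<open>w\<close> would be
  divisible by \<open>r\<close> and smaller than \<open>r\<close>, hence zero. Then \<open>w\<close>
  is a multiple of \<open>c\<close>, even of \<open>dc\<close>, and so not shorter after
  all.\<close>

lemma dual_lattice_shortest:
  fixes a1 a2 r :: "'a::{field, finite} poly"
  assumes cop: "coprime3 (a1, a2) r" and r: "r \<noteq> 0"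
    and level: "d * (c1 * a1 + c2 * a2) = k * r" and dk: "coprime d k" and c: "coprime c1 c2"
    and short: "absval (emb (d * c1)) \<le> sqrt (absval (emb r))"
      "absval (emb (d * c2)) \<le> sqrt (absval (emb r))"
    and w: "r dvd w1 * a1 + w2 * a2" "w1 \<noteq> 0 \<or> w2 \<noteq> 0"
  shows "max (absval (emb (d * c1))) (absval (emb (d * c2))) \<le> max (absval (emb w1)) (absval (emb w2))"
proof (rule ccontr)
  define M where "M = max (absval (emb (d * c1))) (absval (emb (d * c2)))"
  assume "\<not> ?thesis"
  then have wM: "absval (emb w1) < M" "absval (emb w2) < M"
    by (auto simp: M_def)
  from wM(1) have M0: "M > 0"
    using absval_nonneg[of "emb w1"] by linarith
  then have d0: "d \<noteq> 0"
    by (auto simp: M_def)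
  have "M \<le> sqrt (absval (emb r))"
    using short by (simp add: M_def)
  then have "M * M \<le> sqrt (absval (emb r)) * sqrt (absval (emb r))"
    using M0 by (intro mult_mono) auto
  then have MM: "M * M \<le> absval (emb r)"
    by simp
  have "absval (emb (d * c1)) * absval (emb w2) < M * M"
    "absval (emb (d * c2)) * absval (emb w1) < M * M"
    using wM by (auto intro!: mult_less_square simp: M_def)
  then have "absval (emb (d * c1 * w2 - d * c2 * w1)) < absval (emb r)"
    using MM absval_diff_le[of "emb (d * c1 * w2)" "emb (d * c2 * w1)"]
    by (simp add: emb_diff emb_mult absval_mult mult.assoc)
  moreover have "r dvd d * c1 * w2 - d * c2 * w1"
  proof (rule dual_lattice_det_dvd[OF cop _ w(1)])
    have "d * c1 * a1 + d * c2 * a2 = k * r"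
      unfolding level[symmetric] by (simp add: algebra_simps)
    then show "r dvd d * c1 * a1 + d * c2 * a2"
      by simp
  qed
  ultimately have "d * c1 * w2 - d * c2 * w1 = 0"
    using dvd_absval_less_imp_0 by blast
  then have "d * (c1 * w2) = d * (c2 * w1)"
    by (simp add: algebra_simps)
  with d0 have "c1 * w2 = c2 * w1"
    by simp
  with c obtain e where e: "w1 = e * c1" "w2 = e * c2"
    by (rule coprime_parallel)
  obtain m where m: "w1 * a1 + w2 * a2 = r * m"
    using w(1) by (elim dvdE)
  \<comment> \<open>Evaluating \<open>d * (w1 * a1 + w2 * a2)\<close> in two ways gives
    \<open>k * e = d * m\<close>; coprimality of \<open>d\<close> and \<open>k\<close> then forces
    \<open>d\<close> to divide \<open>e\<close>.\<close>
  have "r * (d * m) = d * (w1 * a1 + w2 * a2)"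
    by (simp add: m)
  also have "\<dots> = e * (d * (c1 * a1 + c2 * a2))"
    by (simp add: e algebra_simps)
  also have "\<dots> = r * (k * e)"
    by (simp add: level)
  finally have "k * e = d * m"
    using r by simp
  then have "d dvd e"
    using coprime_poly_dvd_mult[OF dk, of e] by simp
  moreover have "e \<noteq> 0"
    using e w(2) by auto
  ultimately have "absval (emb d) \<le> absval (emb e)"
    by (rule absval_emb_le_of_dvd)
  then have "absval (emb (d * c1)) \<le> absval (emb w1)" "absval (emb (d * c2)) \<le> absval (emb w2)"
    by (simp_all add: e emb_mult absval_mult mult_right_mono)
  then have "M \<le> max (absval (emb w1)) (absval (emb w2))"
    unfolding M_def by (rule max.mono)
  with wM show False
    by linarith
qed

text \<open>Each term of the determinant of \<open>dc\<close> and \<open>d'c'\<close> pairs a first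
  coordinate with a second one, whose bound is strict. So the determinant is smaller than
  \<open>r\<close> and vanishes, the primitive vectors are parallel, and their normalisation makes
  them equal.\<close>

lemma generalised_line_unique:
  fixes a1 a2 r :: "'a::{field, finite} poly"
  assumes cop: "coprime3 (a1, a2) r" and r: "r \<noteq> 0"
    and level: "d * (c1 * a1 + c2 * a2) = k * r" "d' * (c1' * a1 + c2' * a2) = k' * r"
    and dk: "coprime d k" "coprime d' k'" and d: "monic d" "monic d'"
    and c: "primitive_vec (c1, c2)" "primitive_vec (c1', c2')"
    and fst_le: "absval (emb (d * c1)) \<le> sqrt (absval (emb r))"
      "absval (emb (d' * c1')) \<le> sqrt (absval (emb r))"
    and snd_less: "absval (emb (d * c2)) < sqrt (absval (emb r))"
      "absval (emb (d' * c2')) < sqrt (absval (emb r))"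
  shows "d' = d" "c1' = c1" "c2' = c2"
proof -
  have d0: "d \<noteq> 0" "d' \<noteq> 0"
    using d by (auto simp: monic_def)
  have "absval (emb (d * c1)) * absval (emb (d' * c2')) < sqrt (absval (emb r)) * sqrt (absval (emb r))"
    "absval (emb (d' * c1')) * absval (emb (d * c2)) < sqrt (absval (emb r)) * sqrt (absval (emb r))"
    by (rule mult_less_square; use fst_le snd_less in simp)+
  then have "absval (emb (d * c1 * (d' * c2') - d * c2 * (d' * c1'))) < absval (emb r)"
    using absval_diff_le[of "emb (d * c1 * (d' * c2'))" "emb (d * c2 * (d' * c1'))"]
    by (simp add: emb_diff emb_mult absval_mult ac_simps)
  moreover have "r dvd d * c1 * (d' * c2') - d * c2 * (d' * c1')"
  proof (rule dual_lattice_det_dvd[OF cop])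
    have "d * c1 * a1 + d * c2 * a2 = k * r" "d' * c1' * a1 + d' * c2' * a2 = k' * r"
      unfolding level[symmetric] by (simp_all add: algebra_simps)
    then show "r dvd d * c1 * a1 + d * c2 * a2" "r dvd d' * c1' * a1 + d' * c2' * a2"
      by simp_all
  qed
  ultimately have "d * c1 * (d' * c2') - d * c2 * (d' * c1') = 0"
    using dvd_absval_less_imp_0 by blast
  then have "(d * d') * (c1 * c2') = (d * d') * (c2 * c1')"
    by (simp add: algebra_simps)
  with d0 have par: "c1 * c2' = c2 * c1'"
    by simp
  have "coprime c1 c2" "coprime c1' c2'"
    using c by (auto simp: primitive_vec_def)
  moreover have "c1' * c2 = c2' * c1"
    using par by (simp add: mult.commute)
  ultimately have "c1 dvd c1'" "c1' dvd c1" "c2 dvd c2'" "c2' dvd c2"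
    using par coprime_parallel dvd_triv_right by metis+
  \<comment> \<open>If the first coordinates are nonzero, they are monic, hence equal, and
    \<open>par\<close> gives the second ones; otherwise both second coordinates are monic.\<close>
  then show c_eq: "c1' = c1" "c2' = c2"
    using c par monic_dvd_antisym[of c1' c1] monic_dvd_antisym[of c2' c2]
    by (auto simp: primitive_vec_def monic_def)
  \<comment> \<open>With the same \<open>c\<close> on both sides, the two levels give
    \<open>k * d' = k' * d\<close>, so that \<open>d\<close> and \<open>d'\<close> divide each
    other.\<close>
  have "r * (k * d') = d' * (d * (c1 * a1 + c2 * a2))"
    by (simp add: level)
  also have "\<dots> = d * (d' * (c1' * a1 + c2' * a2))"
    by (simp add: c_eq)
  also have "\<dots> = r * (k' * d)"
    by (simp add: level)
  finally have kd: "k * d' = k' * d"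
    using r by simp
  have "d dvd d'" "d' dvd d"
    using coprime_poly_dvd_mult[OF dk(1), of d'] coprime_poly_dvd_mult[OF dk(2), of d] kd
    by (simp, metis dvd_triv_right)
  then show "d' = d"
    using d by (intro monic_dvd_antisym)
qed


section \<open>Pigeonhole arguments\<close>

text \<open>Bounding coefficients instead of the degree keeps the zero polynomial in the set for
  \<open>n = 0\<close> as well, so that the cardinality is q^n in every case.\<close>

definition polys_below :: "nat \<Rightarrow> 'a::zero poly set" where
  "polys_below n = {p. \<forall>i\<ge>n. coeff p i = 0}"

lemma polys_below_bij: "bij_betw Poly {xs. length xs = n \<and> set xs \<subseteq> UNIV} (polys_below n)"
proof (rule bij_betw_byWitness[where f' = "\<lambda>p. map (coeff p) [0..<n]"])
  show "\<forall>xs\<in>{xs. length xs = n \<and> set xs \<subseteq> UNIV}. map (coeff (Poly xs)) [0..<n] = xs"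
    by (auto intro!: nth_equalityI simp: nth_default_nth)
  show "\<forall>p\<in>polys_below n. Poly (map (coeff p) [0..<n]) = p"
    by (auto intro!: poly_eqI simp: polys_below_def nth_default_def)
qed (auto simp: polys_below_def nth_default_def)

lemma finite_polys_below: "finite (polys_below n :: 'a::{zero, finite} poly set)"
  using bij_betw_finite[OF polys_below_bij[where 'a='a, of n]] finite_lists_length_eq[of "UNIV :: 'a set" n]
  by (simp add: conj_commute)

lemma card_polys_below: "card (polys_below n :: 'a::{zero, finite} poly set) = CARD('a) ^ n"
  using bij_betw_same_card[OF polys_below_bij[where 'a='a, of n]] card_lists_length_eq[of "UNIV :: 'a set" n]
  by (simp add: conj_commute)

lemma polys_below_diff: "p \<in> polys_below n \<Longrightarrow> s \<in> polys_below n \<Longrightarrow> p - s \<in> polys_below n"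
  by (simp add: polys_below_def)

lemma degree_polys_below:
  assumes "p \<in> polys_below n" "p \<noteq> 0"
  shows "degree p < n"
proof (rule ccontr)
  assume "\<not> degree p < n"
  with assms(1) have "lead_coeff p = 0"
    by (simp add: polys_below_def)
  with assms(2) show False by simp
qed

section \<open>Simultaneous approximation and short dual vectors\<close>

lemma fls_polynomial_part:
  fixes z :: "'a::{field, finite} fls"
  obtains a where "\<And>n. n \<le> 0 \<Longrightarrow> fls_nth (emb a) n = fls_nth z n"
proof -
  define N where "N = Suc (nat (- fls_subdegree z))"
  have "fls_nth z n = 0" if "\<not> nat (- n) < N" for n
    using that by (intro fls_eq0_below_subdegree) (auto simp: N_def)
  then have "fls_nth (emb (Poly (map (\<lambda>i. fls_nth z (- int i)) [0..<N]))) n = fls_nth z n" if "n \<le> 0" for n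
    using that by (auto simp: emb_nth nth_default_def)
  then show ?thesis by (rule that)
qed

text \<open>There are more polynomials \<open>p\<close> of degree at most Q than patterns formed by
  the first \<lfloor>Q/2\<rfloor> digits of \<open>p * x\<close> and \<open>p * y\<close> after the
  polynomial part. Two polynomials with the same pattern differ by a suitable
  \<open>r\<close>.\<close>

lemma simultaneous_dirichlet:
  fixes x y :: "'a::{field, finite} fls"
  assumes "Q \<ge> 0"
  obtains r a1 a2 where "r \<noteq> 0" "absval (emb r) \<le> real CARD('a) powr Q"
    "absval (emb r * x - emb a1) < real CARD('a) powr (- Q / 2)"
    "absval (emb r * y - emb a2) < real CARD('a) powr (- Q / 2)"
proof -
  define m where "m = nat \<lfloor>Q / 2\<rfloor>"
  define N where "N = nat \<lfloor>Q\<rfloor>"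
  have m: "int m = \<lfloor>Q / 2\<rfloor>" and N: "int N = \<lfloor>Q\<rfloor>"
    using assms by (simp_all add: m_def N_def)
  have mN: "m + m < Suc N"
    using m N by linarith
  \<comment> \<open>The variable is 1/t, so index 0 still belongs to the polynomial part and the
    fractional digits start at index 1.\<close>
  define digits where "digits z = map (\<lambda>j. fls_nth z (int j + 1)) [0..<m]" for z :: "'a fls"
  define f where "f p = (digits (emb p * x), digits (emb p * y))" for p
  define B where "B = {xs :: 'a list. set xs \<subseteq> UNIV \<and> length xs = m}"
  have "f ` polys_below (Suc N) \<subseteq> B \<times> B"
    by (auto simp: f_def B_def digits_def)
  moreover have "finite B"
    unfolding B_def by (rule finite_lists_length_eq) simp
  moreover have "card B = CARD('a) ^ m"
    unfolding B_def by (rule card_lists_length_eq) simp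
  ultimately have "card (f ` polys_below (Suc N)) \<le> CARD('a) ^ (m + m)"
    using card_mono[of "B \<times> B" "f ` polys_below (Suc N)"]
    by (simp add: card_cartesian_product power_add)
  also have "\<dots> < CARD('a) ^ Suc N"
    using card_field_ge_2[where 'a='a] mN by (intro power_strict_increasing) linarith+
  finally have "\<not> inj_on f (polys_below (Suc N))"
    by (intro pigeonhole) (simp add: card_polys_below)
  then obtain p s where ps: "p \<in> polys_below (Suc N)" "s \<in> polys_below (Suc N)" "f p = f s" "p \<noteq> s"
    by (auto simp: inj_on_def)
  define r where "r = p - s"
  have r0: "r \<noteq> 0"
    using ps by (simp add: r_def)
  have "degree r < Suc N"
    using ps(1,2) r0 unfolding r_def by (intro degree_polys_below polys_below_diff)
  with N have "real (degree r) \<le> Q"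
    by linarith
  then have size: "absval (emb r) \<le> real CARD('a) powr Q"
    using r0 card_field_gt_1[where 'a='a] by (simp add: absval_emb flip: powr_realpow)
  have frac: "\<exists>a. absval (emb r * z - emb a) < real CARD('a) powr (- Q / 2)"
    if "digits (emb p * z) = digits (emb s * z)" for z
  proof -
    have digit: "fls_nth (emb r * z) (int j + 1) = 0" if "j < m" for j
      using \<open>digits (emb p * z) = digits (emb s * z)\<close> that
      by (simp add: digits_def r_def emb_diff left_diff_distrib)
    obtain a where a: "\<And>n. n \<le> 0 \<Longrightarrow> fls_nth (emb a) n = fls_nth (emb r * z) n"
      using fls_polynomial_part by blast
    have "fls_nth (emb r * z - emb a) n = 0" if "n \<le> int m" for n
    proof (cases "n \<le> 0")
      case True
      then show ?thesis by (simp add: a)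
    next
      case False
      with digit[of "nat (n - 1)"] that show ?thesis
        by (simp add: emb_nth)
    qed
    \<comment> \<open>Rounding Q/2 down costs nothing: the first index that may survive is
      \<open>m + 1\<close>, which exceeds Q/2.\<close>
    moreover have "- (- Q / 2) < real_of_int (int m) + 1"
      using m by linarith
    ultimately have "absval (emb r * z - emb a) < real CARD('a) powr (- Q / 2)"
      by (rule absval_less_powr)
    then show ?thesis by blast
  qed
  from ps(3) have "digits (emb p * x) = digits (emb s * x)" "digits (emb p * y) = digits (emb s * y)"
    by (simp_all add: f_def)
  with frac[of x] frac[of y] r0 size show ?thesis
    using that by blast
qed

text \<open>The pairs in the box \<open>A\<close> have n + 1 free coefficients in total, but there
  are only q^n residues modulo \<open>r\<close>; the difference of two pairs with the same residue
  is the vector sought.\<close>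

lemma dual_lattice_minkowski:
  fixes r a1 a2 :: "'a::{field, finite} poly"
  assumes r: "r \<noteq> 0"
  obtains w1 w2 where "w1 \<noteq> 0 \<or> w2 \<noteq> 0" "r dvd w1 * a1 + w2 * a2"
    "absval (emb w1) \<le> sqrt (absval (emb r))" "absval (emb w2) < sqrt (absval (emb r))"
proof -
  define n where "n = degree r"
  \<comment> \<open>The degrees are at most n/2 in the first coordinate and strictly below n/2 in
    the second: \<open>(n + 1) div 2\<close> is n/2 rounded up.\<close>
  define A :: "('a poly \<times> 'a poly) set"
    where "A = polys_below (Suc (n div 2)) \<times> polys_below ((n + 1) div 2)"
  define f where "f = (\<lambda>(w1, w2). (w1 * a1 + w2 * a2) mod r)"
  have "f ` A \<subseteq> polys_below n"
  proof
    fix p assume "p \<in> f ` A"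
    then obtain s where "p = s mod r"
      by (auto simp: f_def)
    then have "p = 0 \<or> degree p < n"
      using degree_mod_less[OF r] by (simp add: n_def)
    then show "p \<in> polys_below n"
      by (auto simp: polys_below_def coeff_eq_0)
  qed
  then have "card (f ` A) \<le> CARD('a) ^ n"
    using card_mono[OF finite_polys_below] card_polys_below by metis
  also have "\<dots> < CARD('a) ^ (Suc (n div 2) + (n + 1) div 2)"
    using card_field_ge_2[where 'a='a] by (intro power_strict_increasing) linarith+
  also have "\<dots> = card A"
    by (simp only: A_def card_cartesian_product card_polys_below power_add)
  finally have "\<not> inj_on f A"
    by (rule pigeonhole)
  then obtain u v where uv: "u \<in> A" "v \<in> A" "f u = f v" "u \<noteq> v"
    by (auto simp: inj_on_def)
  define w1 w2 where "w1 = fst u - fst v" and "w2 = snd u - snd v"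
  have below: "w1 \<in> polys_below (Suc (n div 2))" "w2 \<in> polys_below ((n + 1) div 2)"
    using uv(1,2) by (auto simp: w1_def w2_def A_def intro: polys_below_diff)
  have q1: "real CARD('a) > 1"
    by (rule card_field_gt_1)
  have Nr: "absval (emb r) = real CARD('a) ^ n"
    using r by (simp add: absval_emb n_def)
  show ?thesis
  proof (rule that[of w1 w2])
    show "w1 \<noteq> 0 \<or> w2 \<noteq> 0"
      using uv(4) by (auto simp: w1_def w2_def prod_eq_iff)
    have "r dvd (fst u * a1 + snd u * a2) - (fst v * a1 + snd v * a2)"
      using uv(3) by (simp add: f_def case_prod_beta mod_eq_dvd_iff)
    then show "r dvd w1 * a1 + w2 * a2"
      by (simp add: w1_def w2_def algebra_simps)
    show "absval (emb w1) \<le> sqrt (absval (emb r))"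
    proof (cases "w1 = 0")
      case False
      with degree_polys_below[OF below(1)] have "degree w1 + degree w1 \<le> n"
        by linarith
      then have "real CARD('a) ^ (degree w1 + degree w1) \<le> real CARD('a) ^ n"
        using q1 by (intro power_increasing) auto
      with False show ?thesis
        by (intro real_le_rsqrt) (simp add: absval_emb Nr power2_eq_square power_add)
    qed simp
    show "absval (emb w2) < sqrt (absval (emb r))"
    proof (cases "w2 = 0")
      case False
      with degree_polys_below[OF below(2)] have "degree w2 + degree w2 < n"
        by linarith
      then have "real CARD('a) ^ (degree w2 + degree w2) < real CARD('a) ^ n"
        using q1 by (intro power_strict_increasing) auto
      with False show ?thesis
        by (intro real_less_rsqrt) (simp add: absval_emb Nr power2_eq_square power_add)
    qed (use r in simp)
  qed
qed

section \<open>The Farey dissection\<close>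

lemma frac_pt_in_unit_balls_iff:
  fixes r :: "'a::{field, finite} poly"
  assumes "r \<noteq> 0"
  shows "frac_pt (a1, a2) r \<in> unit_ball \<times> unit_ball \<longleftrightarrow>
    absval (emb a1) < absval (emb r) \<and> absval (emb a2) < absval (emb r)"
proof -
  have "absval (emb r) > 0"
    using assms by simp
  then show ?thesis
    by (simp add: frac_pt_def unit_ball_def absval_divide)
qed

lemma frac_pt_in_line_level_iff:
  fixes r :: "'a::{field, finite} poly"
  assumes "r \<noteq> 0"
  shows "frac_pt (a1, a2) r \<in> line_level d (c1, c2) k \<longleftrightarrow> d * (c1 * a1 + c2 * a2) = k * r"
proof -
  have r: "emb r \<noteq> 0"
    using assms by simp
  have "frac_pt (a1, a2) r \<in> line_level d (c1, c2) k \<longleftrightarrow>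
      emb d * (emb c1 * emb a1 + emb c2 * emb a2) / emb r = emb k"
    by (simp add: frac_pt_def line_level_def flip: add_divide_distrib)
  also have "\<dots> \<longleftrightarrow> emb (d * (c1 * a1 + c2 * a2)) = emb (k * r)"
    using r by (simp add: divide_eq_eq emb_mult emb_add)
  finally show ?thesis
    by (simp only: emb_eq_iff)
qed

text \<open>The generalised line quantifies over all representations of its points. The ball and the
  level depend on the point alone, and the given lowest-terms representation serves as a
  witness.\<close>

lemma frac_pt_in_gen_line_iff:
  fixes r :: "'a::{field, finite} poly"
  assumes "r \<noteq> 0" "coprime3 (a1, a2) r"
  shows "frac_pt (a1, a2) r \<in> gen_line d (c1, c2) \<longleftrightarrow>
    absval (emb a1) < absval (emb r) \<and> absval (emb a2) < absval (emb r) \<and>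
    (\<exists>k. coprime d k \<and> d * (c1 * a1 + c2 * a2) = k * r)"
proof -
  have "frac_pt (a1, a2) r \<in> gen_line d (c1, c2) \<longleftrightarrow> frac_pt (a1, a2) r \<in> unit_ball \<times> unit_ball \<and>
      (\<exists>k. coprime d k \<and> frac_pt (a1, a2) r \<in> line_level d (c1, c2) k)"
    (is "?lhs \<longleftrightarrow> ?rhs")
  proof
    assume ?lhs
    then obtain a' r' k where "frac_pt (a1, a2) r = frac_pt a' r'" "coprime d k"
      "frac_pt a' r' \<in> (unit_ball \<times> unit_ball) \<inter> line_level d (c1, c2) k"
      unfolding gen_line_def mem_Collect_eq by metis
    then show ?rhs
      by (metis IntD1 IntD2)
  next
    assume ?rhs
    then obtain k where "frac_pt (a1, a2) r \<in> (unit_ball \<times> unit_ball) \<inter> line_level d (c1, c2) k"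
      "coprime d k"
      by (metis IntI)
    with assms show ?lhs
      unfolding gen_line_def mem_Collect_eq by metis
  qed
  then show ?thesis
    by (simp only: frac_pt_in_unit_balls_iff[OF assms(1)] frac_pt_in_line_level_iff[OF assms(1)] conj_assoc)
qed

lemma farey_index_iff:
  fixes r :: "'a::{field, finite} poly"
  shows "(r, d, (c1, c2), (a1, a2)) \<in> farey_index Q \<longleftrightarrow>
    monic r \<and> absval (emb r) \<le> real CARD('a) powr Q \<and> monic d \<and> primitive_vec (c1, c2) \<and>
    absval (emb r) * real CARD('a) powr (- Q / 2) \<le> max (absval (emb (d * c1))) (absval (emb (d * c2))) \<and>
    absval (emb (d * c1)) \<le> sqrt (absval (emb r)) \<and> absval (emb (d * c2)) < sqrt (absval (emb r)) \<and>
    absval (emb a1) < absval (emb r) \<and> absval (emb a2) < absval (emb r) \<and> coprime3 (a1, a2) r \<and>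
    (\<exists>k. coprime d k \<and> d * (c1 * a1 + c2 * a2) = k * r)"
    (is "?lhs \<longleftrightarrow> ?rhs")
proof -
  have r0: "monic r \<Longrightarrow> r \<noteq> 0"
    by (auto simp: monic_def)
  \<comment> \<open>\<open>d\<close> divides the product \<open>k * r\<close> and is coprime to
    \<open>k\<close>.\<close>
  have dvd: "d dvd r" if "coprime d k" "d * (c1 * a1 + c2 * a2) = k * r" for k
    using that coprime_poly_dvd_mult dvd_triv_left by metis
  have sqrt: "max (absval (emb (d * c1))) (absval (emb (d * c2))) \<le> sqrt (absval (emb r)) \<and>
      absval (emb (d * c2)) < sqrt (absval (emb r)) \<longleftrightarrow>
      absval (emb (d * c1)) \<le> sqrt (absval (emb r)) \<and> absval (emb (d * c2)) < sqrt (absval (emb r))"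
    by auto
  show ?thesis
    unfolding farey_index_def
    using r0 dvd sqrt frac_pt_in_gen_line_iff[of r a1 a2 d c1 c2]
    by (simp add: vabsval_def vemb_def smul_def) blast
qed

text \<open>Multiplying the distance by the absolute value of \<open>r\<close> clears the
  denominator and leaves the same bound q^(-Q/2) for every \<open>r\<close>.\<close>

lemma farey_box_iff:
  fixes r :: "'a::{field, finite} poly"
  assumes "r \<noteq> 0"
  shows "(x, y) \<in> farey_box (a1, a2) r Q \<longleftrightarrow> absval x < 1 \<and> absval y < 1 \<and>
    absval (emb r * x - emb a1) < real CARD('a) powr (- Q / 2) \<and>
    absval (emb r * y - emb a2) < real CARD('a) powr (- Q / 2)"
proof -
  have r: "emb r \<noteq> 0"
    using assms by simp
  have "absval (z - emb a / emb r) < inverse (absval (emb r)) * t \<longleftrightarrow> absval (emb r * z - emb a) < t"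
    for z a t
  proof -
    have "z - emb a / emb r = (emb r * z - emb a) / emb r"
      using r by (simp add: diff_divide_distrib)
    moreover have "absval (emb r) > 0"
      using r by simp
    ultimately show ?thesis
      by (simp only: absval_divide inverse_eq_divide) (simp add: divide_less_eq del: absval_pos_iff)
  qed
  then show ?thesis
    by (simp add: farey_box_def unit_ball_def vabsval_def frac_pt_def)
qed

text \<open>
  If the box of another fraction of no larger denominator met the box of the given one, then
  \<open>r a' - r' a\<close>, rotated by a right angle, would lie in the dual lattice and be shorter than its
  minimum.
\<close>

lemma farey_fraction_unique_aux:
  fixes r r' :: "'a::{field, finite} poly"
  assumes ind: "(r, d, (c1, c2), (a1, a2)) \<in> farey_index Q" "(r', d', (c1', c2'), (a1', a2')) \<in> farey_index Q"
    and box: "(x, y) \<in> farey_box (a1, a2) r Q" "(x, y) \<in> farey_box (a1', a2') r' Q"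
    and le: "absval (emb r') \<le> absval (emb r)"
  shows "r' = r \<and> a1' = a1 \<and> a2' = a2"
proof -
  define T where "T = real CARD('a) powr (- Q / 2)"
  have monic: "monic r" "monic r'"
    using ind by (simp_all add: farey_index_iff)
  then have r0: "r \<noteq> 0" "r' \<noteq> 0"
    by (auto simp: monic_def)
  have cop: "coprime3 (a1, a2) r" "coprime3 (a1', a2') r'"
    using ind by (simp_all add: farey_index_iff)
  have T: "T > 0"
    using card_field_gt_1[where 'a='a] by (simp add: T_def)
  \<comment> \<open>This is \<open>r * r'\<close> times the difference of the fractions a'/r' and
    a/r in one coordinate.\<close>
  define v where "v a a' = r * a' - r' * a" for a a'
  have v_less: "absval (emb (v a a')) < absval (emb r) * T"
    if "absval (emb r * z - emb a) < T" "absval (emb r' * z - emb a') < T" for a a' z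
  proof -
    \<comment> \<open>The common point \<open>z\<close> of the two boxes cancels; as r' is not
      larger than \<open>r\<close>, both terms are below the absolute value of \<open>r\<close>
      times \<open>T\<close>.\<close>
    have "emb (v a a') = emb r' * (emb r * z - emb a) - emb r * (emb r' * z - emb a')"
      by (simp add: v_def emb_diff emb_mult algebra_simps)
    also have "absval \<dots> \<le> max (absval (emb r') * absval (emb r * z - emb a))
        (absval (emb r) * absval (emb r' * z - emb a'))"
      unfolding absval_mult[symmetric] by (rule absval_diff_le)
    also have "\<dots> < absval (emb r) * T"
    proof -
      have "absval (emb r') * absval (emb r * z - emb a) \<le> absval (emb r) * absval (emb r * z - emb a)"
        using le by (rule mult_right_mono) simp
      also have "\<dots> < absval (emb r) * T"
        using that(1) r0 by (intro mult_strict_left_mono) auto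
      moreover have "absval (emb r) * absval (emb r' * z - emb a') < absval (emb r) * T"
        using that(2) r0 by (intro mult_strict_left_mono) auto
      ultimately show ?thesis by simp
    qed
    finally show ?thesis .
  qed
  have small: "absval (emb (v a1 a1')) < absval (emb r) * T" "absval (emb (v a2 a2')) < absval (emb r) * T"
    using box r0 v_less by (auto simp: farey_box_iff T_def)
  have "v a2 a2' * a1 + (- v a1 a1') * a2 = r * (a2' * a1 - a1' * a2)"
    by (simp add: v_def algebra_simps)
  then have dual: "r dvd v a2 a2' * a1 + (- v a1 a1') * a2"
    by simp
  obtain k where k: "coprime d k" "d * (c1 * a1 + c2 * a2) = k * r"
    using ind(1) by (auto simp: farey_index_iff)
  have "v a2 a2' = 0 \<and> - v a1 a1' = 0"
  proof (rule ccontr)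
    assume "\<not> ?thesis"
    then have "max (absval (emb (d * c1))) (absval (emb (d * c2)))
        \<le> max (absval (emb (v a2 a2'))) (absval (emb (- v a1 a1')))"
      using ind(1) by (intro dual_lattice_shortest[OF cop(1) r0(1) k(2,1) _ _ _ dual])
        (auto simp: farey_index_iff primitive_vec_def)
    moreover have "absval (emb r) * T \<le> max (absval (emb (d * c1))) (absval (emb (d * c2)))"
      using ind(1) by (simp add: farey_index_iff T_def)
    ultimately show False
      using small unfolding emb_minus absval_minus by linarith
  qed
  then have eq: "r * a1' = r' * a1" "r * a2' = r' * a2"
    by (simp_all add: v_def)
  have "r dvd r'"
    by (rule coprime3_dvd[OF cop(1)]) (simp_all flip: eq)
  moreover have "r' dvd r"
    by (rule coprime3_dvd[OF cop(2)]) (simp_all add: eq)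
  ultimately have "r' = r"
    using monic by (intro monic_dvd_antisym)
  with eq r0 show ?thesis
    by simp
qed

text \<open>First the fractions agree, with the larger denominator taken as the reference one; then
  two lines through the same fraction agree by \<open>generalised_line_unique\<close>.\<close>

lemma farey_index_unique:
  fixes r r' :: "'a::{field, finite} poly"
  assumes ind: "(r, d, (c1, c2), (a1, a2)) \<in> farey_index Q" "(r', d', (c1', c2'), (a1', a2')) \<in> farey_index Q"
    and box: "(x, y) \<in> farey_box (a1, a2) r Q" "(x, y) \<in> farey_box (a1', a2') r' Q"
  shows "(r', d', (c1', c2'), (a1', a2')) = (r, d, (c1, c2), (a1, a2))"
proof -
  have eq: "r' = r" "a1' = a1" "a2' = a2"
    using farey_fraction_unique_aux[OF ind box] farey_fraction_unique_aux[OF ind(2,1) box(2,1)]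
    by (metis linear)+
  obtain k k' where k: "coprime d k" "d * (c1 * a1 + c2 * a2) = k * r"
    "coprime d' k'" "d' * (c1' * a1 + c2' * a2) = k' * r"
    using ind by (auto simp: farey_index_iff eq)
  have "coprime3 (a1, a2) r" "r \<noteq> 0" and d: "monic d" "monic d'"
    and c: "primitive_vec (c1, c2)" "primitive_vec (c1', c2')"
    and le: "absval (emb (d * c1)) \<le> sqrt (absval (emb r))" "absval (emb (d' * c1')) \<le> sqrt (absval (emb r))"
    and less: "absval (emb (d * c2)) < sqrt (absval (emb r))" "absval (emb (d' * c2')) < sqrt (absval (emb r))"
    using ind by (auto simp: farey_index_iff eq monic_def)
  from generalised_line_unique[OF this(1,2) k(2,4,1,3) d c le less] eq show ?thesis
    by simp
qed


text \<open>
  If the dual lattice contained a vector shorter than \<open>\<bar>r\<bar> q^(-Q/2)\<close>, its rotation by a right angle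
  would be congruent to a multiple \<open>r' a\<close> of \<open>a\<close> modulo \<open>r\<close>, and \<open>r'\<close> would be a smaller admissible
  denominator.
\<close>

lemma dual_lattice_vector_imp_smaller_denominator:
  fixes r a1 a2 :: "'a::{field, finite} poly"
  assumes cop: "coprime3 (a1, a2) r" and r: "r \<noteq> 0" and T: "T \<le> 1"
    and approx: "absval (emb r * x - emb a1) < T" "absval (emb r * y - emb a2) < T"
    and w: "r dvd w1 * a1 + w2 * a2" "w1 \<noteq> 0 \<or> w2 \<noteq> 0"
    and short: "absval (emb w1) < absval (emb r) * T" "absval (emb w2) < absval (emb r) * T"
  obtains r' a1' a2' where "r' \<noteq> 0" "degree r' < degree r"
    "absval (emb r' * x - emb a1') < T" "absval (emb r' * y - emb a2') < T"
proof -
  obtain u1 u2 u where u: "u1 * a1 + u2 * a2 + u * r = 1"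
    using cop by (rule coprime3_bezout)
  \<comment> \<open>The wanted congruence of \<open>s * a\<close> with \<open>(w2, - w1)\<close>
    modulo \<open>r\<close> determines \<open>s\<close>: pair both sides with
    \<open>(u1, u2)\<close>, whose product with \<open>a\<close> is 1 modulo
    \<open>r\<close>.\<close>
  define s where "s = u1 * w2 - u2 * w1"
  define r' where "r' = s mod r"
  have one: "p = (u1 * a1 + u2 * a2 + u * r) * p" for p
    by (simp add: u)
  have "s * a1 - w2 = - (u2 * (w1 * a1 + w2 * a2)) - r * (u * w2)"
    by (subst one[of w2]) (simp add: s_def algebra_simps)
  then have s1: "r dvd s * a1 - w2"
    using w(1) by simp
  have "s * a2 - (- w1) = u1 * (w1 * a1 + w2 * a2) + r * (u * w1)"
    by (subst one[of w1]) (simp add: s_def algebra_simps)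
  then have s2: "r dvd s * a2 - (- w1)"
    using w(1) by simp
  have r's: "r dvd s - r'"
    by (simp add: r'_def minus_mod_eq_div_mult)
  have reduce: "\<exists>b. r' * a - v = r * b" if "r dvd s * a - v" for a v
  proof -
    have "r' * a - v = (s * a - v) - (s - r') * a"
      by (simp add: algebra_simps)
    with that r's have "r dvd r' * a - v"
      by (metis dvd_diff dvd_mult2)
    then show ?thesis
      by (elim dvdE) blast
  qed
  obtain a1' where a1': "r' * a1 - w2 = r * a1'"
    using reduce[OF s1] by blast
  obtain a2' where a2': "r' * a2 - (- w1) = r * a2'"
    using reduce[OF s2] by blast
  have r_pos: "absval (emb r) > 0"
    using r by simp
  have "absval (emb r) * T \<le> absval (emb r)"
    using T mult_left_mono[of T 1 "absval (emb r)"] by simp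
  with short have short': "absval (emb w1) < absval (emb r)" "absval (emb w2) < absval (emb r)"
    by linarith+
  \<comment> \<open>Otherwise \<open>r\<close> would divide both coordinates of \<open>w\<close>,
    which are smaller than \<open>r\<close> and not both zero.\<close>
  have r'0: "r' \<noteq> 0"
  proof
    assume "r' = 0"
    with a1' a2' have "w2 = r * (- a1')" "w1 = r * a2'"
      by (simp_all add: minus_equation_iff[of w2])
    then have "r dvd w2" "r dvd w1"
      by simp_all
    with short' have "w2 = 0" "w1 = 0"
      using dvd_absval_less_imp_0 by blast+
    with w(2) show False by simp
  qed
  then have deg: "degree r' < degree r"
    using degree_mod_less[OF r, of s] by (simp add: r'_def)
  then have r'r: "absval (emb r') \<le> absval (emb r)"
    using absval_emb_less_iff[OF r'0 r] by simp
  have approx': "absval (emb r' * z - emb b) < T"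
    if z: "absval (emb r * z - emb a) < T" and b: "r' * a - v = r * b"
      and v: "absval (emb v) < absval (emb r) * T" for z a b v
  proof -
    have "emb r * emb b = emb r' * emb a - emb v"
      unfolding emb_mult[symmetric] emb_diff[symmetric] b ..
    \<comment> \<open>The new error is split into the old one, scaled by r', and the short vector;
      both terms are below the absolute value of \<open>r\<close> times \<open>T\<close>.\<close>
    then have "emb r * (emb r' * z - emb b) = emb r' * (emb r * z - emb a) + emb v"
      by (simp add: algebra_simps)
    then have "absval (emb r) * absval (emb r' * z - emb b)
        \<le> max (absval (emb r') * absval (emb r * z - emb a)) (absval (emb v))"
      unfolding absval_mult[symmetric] using absval_add_le by metis
    also have "\<dots> < absval (emb r) * T"
    proof -
      have "absval (emb r') * absval (emb r * z - emb a) \<le> absval (emb r) * absval (emb r * z - emb a)"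
        using r'r by (rule mult_right_mono) simp
      also have "\<dots> < absval (emb r) * T"
        using z r_pos by (intro mult_strict_left_mono)
      finally show ?thesis
        using v by simp
    qed
    finally show ?thesis
      using r_pos by (simp only: mult_less_cancel_left_pos)
  qed
  have "absval (emb (- w1)) < absval (emb r) * T"
    using short(1) by (simp add: emb_minus)
  from that[OF r'0 deg approx'[OF approx(1) a1' short(2)] approx'[OF approx(2) a2' this]]
  show ?thesis .
qed

section \<open>Existence of an index whose box contains a given point\<close>

lemma coprime_smult:
  fixes p s :: "'a::field poly"
  assumes "coprime p s" "u \<noteq> 0" "v \<noteq> 0"
  shows "coprime (smult u p) (smult v s)"
  using assms by (auto simp: dvd_smult_iff intro!: coprimeI elim: coprime_common_divisor)

lemma primitive_vec_normalise:
  assumes "coprime c1 c2"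
  obtains u where "u \<noteq> 0" "primitive_vec (smult u c1, smult u c2)"
proof -
  define u where "u = inverse (lead_coeff (if c1 = 0 then c2 else c1))"
  have u: "u \<noteq> 0"
    using assms by (auto simp: u_def)
  have "coprime (smult u c1) (smult u c2)"
    using assms u u by (rule coprime_smult)
  moreover have "c1 = 0 \<Longrightarrow> c2 \<noteq> 0"
    using assms by auto
  ultimately have "primitive_vec (smult u c1, smult u c2)"
    unfolding primitive_vec_def by (simp add: monic_def u_def)
  with u show ?thesis
    by (rule that)
qed

text \<open>A short dual vector factors as \<open>w = e * c\<close> with \<open>c\<close> primitive,
  and its product with \<open>a\<close> is \<open>r * m\<close>. Cancelling the common factor of
  \<open>e\<close> and \<open>m\<close> yields \<open>d\<close> and \<open>k\<close>, and can only
  shorten the vector.\<close>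

lemma short_generalised_line:
  fixes r a1 a2 :: "'a::{field, finite} poly"
  assumes r: "r \<noteq> 0"
  obtains d c1 c2 k where "monic d" "primitive_vec (c1, c2)" "coprime d k"
    "d * (c1 * a1 + c2 * a2) = k * r"
    "absval (emb (d * c1)) \<le> sqrt (absval (emb r))" "absval (emb (d * c2)) < sqrt (absval (emb r))"
proof -
  obtain w1 w2 where w0: "w1 \<noteq> 0 \<or> w2 \<noteq> 0" and w: "r dvd w1 * a1 + w2 * a2"
    and w_le: "absval (emb w1) \<le> sqrt (absval (emb r))" "absval (emb w2) < sqrt (absval (emb r))"
    using r by (rule dual_lattice_minkowski)
  obtain g b1 b2 where g: "g \<noteq> 0" "w1 = g * b1" "w2 = g * b2" "coprime b1 b2"
    using w0 by (rule poly_factor_out_gcd)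
  obtain u where u: "u \<noteq> 0" "primitive_vec (smult u b1, smult u b2)"
    using g(4) by (rule primitive_vec_normalise)
  \<comment> \<open>The unit that normalises \<open>c\<close> is compensated in \<open>e\<close>, so
    that the product is still \<open>w\<close>.\<close>
  define c1 c2 e where "c1 = smult u b1" and "c2 = smult u b2" and "e = smult (inverse u) g"
  have e: "e \<noteq> 0" "w1 = e * c1" "w2 = e * c2"
    using g u(1) by (simp_all add: c1_def c2_def e_def)
  obtain m where m: "w1 * a1 + w2 * a2 = r * m"
    using w by (rule dvdE)
  obtain h d' k' where h: "h \<noteq> 0" "e = h * d'" "m = h * k'" "coprime d' k'"
    using poly_factor_out_gcd[of e m] e(1) by blast
  have d'0: "d' \<noteq> 0"
    using e(1) h(2) by auto
  define l where "l = inverse (lead_coeff d')"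
  have l: "l \<noteq> 0"
    using d'0 by (simp add: l_def)
  define d k where "d = smult l d'" and "k = smult l k'"
  have "h * (d' * (c1 * a1 + c2 * a2)) = w1 * a1 + w2 * a2"
    by (simp add: e h(2) algebra_simps)
  also have "\<dots> = h * (k' * r)"
    by (subst m) (simp add: h(3))
  finally have "d' * (c1 * a1 + c2 * a2) = k' * r"
    using h(1) by simp
  then have level: "d * (c1 * a1 + c2 * a2) = k * r"
    by (simp add: d_def k_def)
  have "d dvd e"
    using l by (simp add: d_def smult_dvd_iff h(2))
  then have "absval (emb d) \<le> absval (emb e)"
    using e(1) by (rule absval_emb_le_of_dvd)
  then have le: "absval (emb (d * c1)) \<le> absval (emb w1)" "absval (emb (d * c2)) \<le> absval (emb w2)"
    by (simp_all add: e emb_mult absval_mult mult_right_mono)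
  show ?thesis
  proof (rule that)
    show "monic d"
      using d'0 by (simp add: d_def l_def monic_def)
    show "primitive_vec (c1, c2)"
      using u(2) by (simp add: c1_def c2_def)
    show "coprime d k"
      unfolding d_def k_def using h(4) l by (intro coprime_smult)
  qed (use level le w_le in simp_all)
qed

text \<open>Take an approximating denominator of least degree. Minimality bounds its size by that of
  the Dirichlet denominator, puts the fraction in lowest terms, and rules out that \<open>dc\<close>
  is shorter than required.\<close>

lemma farey_cover:
  fixes x y :: "'a::{field, finite} fls"
  assumes Q: "Q \<ge> 0" and xy: "absval x < 1" "absval y < 1"
  obtains r d c1 c2 a1 a2 where "(r, d, (c1, c2), (a1, a2)) \<in> farey_index Q" "(x, y) \<in> farey_box (a1, a2) r Q"
proof -
  define T where "T = real CARD('a) powr (- Q / 2)"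
  have "T \<le> real CARD('a) powr 0"
    unfolding T_def using card_field_gt_1[where 'a='a] Q by (intro powr_mono) auto
  then have T: "T \<le> 1"
    using card_field_gt_1[where 'a='a] by simp
  define P where "P r \<longleftrightarrow> r \<noteq> 0 \<and>
    (\<exists>a1 a2. absval (emb r * x - emb a1) < T \<and> absval (emb r * y - emb a2) < T)" for r
  obtain s where s: "P s" "absval (emb s) \<le> real CARD('a) powr Q"
  proof (rule simultaneous_dirichlet[OF Q, of x y])
    fix s a1 a2
    assume "s \<noteq> 0" and le: "absval (emb s) \<le> real CARD('a) powr Q"
      and "absval (emb s * x - emb a1) < real CARD('a) powr (- Q / 2)"
      "absval (emb s * y - emb a2) < real CARD('a) powr (- Q / 2)"
    then have "P s"
      unfolding P_def T_def by blast
    then show ?thesis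
      using le by (rule that)
  qed
  obtain r0 where r0: "P r0" and min: "\<And>r. P r \<Longrightarrow> degree r0 \<le> degree r"
    using s(1) ex_has_least_nat[of P s degree] by blast
  \<comment> \<open>Scaling denominator and numerators by a constant makes \<open>r\<close> monic
    and preserves all absolute values and degrees.\<close>
  define l where "l = inverse (lead_coeff r0)"
  define r where "r = smult l r0"
  have l: "l \<noteq> 0"
    using r0 by (simp add: P_def l_def)
  have monic: "monic r"
    using r0 by (simp add: P_def r_def l_def monic_def)
  then have r: "r \<noteq> 0"
    by (auto simp: monic_def)
  have min: "degree r \<le> degree r'" if "P r'" for r'
    using min[OF that] l by (simp add: r_def)
  obtain b1 b2 where b: "absval (emb r0 * x - emb b1) < T" "absval (emb r0 * y - emb b2) < T"
    using r0 by (auto simp: P_def)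
  define a1 a2 where "a1 = smult l b1" and "a2 = smult l b2"
  have scale: "absval (emb (smult l p) * z - emb (smult l b)) = absval (emb p * z - emb b)" for p b z
  proof -
    have "emb (smult l p) * z - emb (smult l b) = fls_const l * (emb p * z - emb b)"
      by (simp add: emb_smult algebra_simps)
    then show ?thesis
      using l by (simp only: absval_mult) (simp add: absval_def)
  qed
  have approx: "absval (emb r * x - emb a1) < T" "absval (emb r * y - emb a2) < T"
    using b by (simp_all add: r_def a1_def a2_def scale)
  have "absval (emb r) \<le> absval (emb s)"
    using min[OF s(1)] absval_emb_less_iff[of s r] r s(1) by (simp add: P_def)
  with s(2) have size: "absval (emb r) \<le> real CARD('a) powr Q"
    by linarith
  have numerator: "absval (emb a) < absval (emb r)" if "absval (emb r * z - emb a) < T" "absval z < 1" for z a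
  proof -
    \<comment> \<open>The first term is below the absolute value of \<open>r\<close> because
      \<open>z\<close> lies in the unit ball, the second because it is below \<open>T\<close>, which
      is at most 1.\<close>
    have "absval (emb a) \<le> max (absval (emb r * z)) (absval (emb r * z - emb a))"
      using absval_diff_le[of "emb r * z" "emb r * z - emb a"] by simp
    also have "\<dots> < absval (emb r)"
      using that T absval_emb_ge_1[OF r] mult_strict_left_mono[of "absval z" 1 "absval (emb r)"]
      by (simp add: absval_mult r)
    finally show ?thesis .
  qed
  have cop: "coprime3 (a1, a2) r"
    unfolding coprime3_def fst_conv snd_conv
  proof (intro allI impI)
    fix e assume "e dvd a1" "e dvd a2" "e dvd r"
    then obtain a1' a2' r' where e: "a1 = e * a1'" "a2 = e * a2'" "r = e * r'"
      by (elim dvdE) blast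
    have e0: "e \<noteq> 0" "r' \<noteq> 0"
      using r e(3) by auto
    \<comment> \<open>Cancelling a common factor \<open>e\<close> does not increase the error, so r'
      is again an approximating denominator; minimality forces \<open>e\<close> to be
      constant.\<close>
    have "absval (emb r' * z - emb a') < T" if "absval (emb (e * r') * z - emb (e * a')) < T" for z a'
    proof -
      have "emb (e * r') * z - emb (e * a') = emb e * (emb r' * z - emb a')"
        by (simp add: emb_mult algebra_simps)
      with that have "absval (emb e) * absval (emb r' * z - emb a') < T"
        by (simp only: absval_mult)
      moreover have "1 * absval (emb r' * z - emb a') \<le> absval (emb e) * absval (emb r' * z - emb a')"
        using absval_emb_ge_1[OF e0(1)] by (rule mult_right_mono) simp
      ultimately show ?thesis by simp
    qed
    with approx e e0 have "P r'"
      unfolding P_def by blast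
    then have "degree r \<le> degree r'"
      by (rule min)
    then have "degree e = 0"
      using e0 by (simp add: e(3) degree_mult_eq)
    with e0 show "is_unit e"
      by (simp add: is_unit_iff_degree)
  qed
  obtain d c1 c2 k where line: "monic d" "primitive_vec (c1, c2)" "coprime d k"
    "d * (c1 * a1 + c2 * a2) = k * r"
    "absval (emb (d * c1)) \<le> sqrt (absval (emb r))" "absval (emb (d * c2)) < sqrt (absval (emb r))"
    using r by (rule short_generalised_line)
  have long: "absval (emb r) * T \<le> max (absval (emb (d * c1))) (absval (emb (d * c2)))"
  proof (rule ccontr)
    assume "\<not> ?thesis"
    then have short: "absval (emb (d * c1)) < absval (emb r) * T" "absval (emb (d * c2)) < absval (emb r) * T"
      by auto
    have dual: "r dvd (d * c1) * a1 + (d * c2) * a2"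
      using line(4) dvd_triv_right[of r k] by (simp add: algebra_simps)
    have nz: "d * c1 \<noteq> 0 \<or> d * c2 \<noteq> 0"
      using line(1,2) by (auto simp: monic_def primitive_vec_def)
    obtain r' a1' a2' where "r' \<noteq> 0" "degree r' < degree r"
      "absval (emb r' * x - emb a1') < T" "absval (emb r' * y - emb a2') < T"
      by (rule dual_lattice_vector_imp_smaller_denominator[OF cop r T approx dual nz short])
    with min[of r'] show False
      by (auto simp: P_def)
  qed
  show ?thesis
  proof (rule that)
    show "(r, d, (c1, c2), (a1, a2)) \<in> farey_index Q"
      unfolding farey_index_iff T_def[symmetric]
      using monic size line cop long numerator[OF approx(1) xy(1)] numerator[OF approx(2) xy(2)] by blast
    show "(x, y) \<in> farey_box (a1, a2) r Q"
      using approx xy by (simp add: farey_box_iff[OF r] T_def)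
  qed
qed

theorem theorem1p1:
  fixes Q :: real
  assumes "odd CARD('a::{field, finite})"
    and "Q > 0"
  shows "disjoint_family_on (\<lambda>(r, d, c, a). farey_box a r Q) (farey_index Q ::
           ('a poly \<times> 'a poly \<times> ('a poly \<times> 'a poly) \<times> ('a poly \<times> 'a poly)) set) \<and>
         (\<Union>(r, d, c, a)\<in>farey_index Q. farey_box a r Q) =
           (unit_ball \<times> unit_ball :: ('a fls \<times> 'a fls) set)"
proof
  show "disjoint_family_on (\<lambda>(r, d, c, a). farey_box a r Q) (farey_index Q ::
      ('a poly \<times> 'a poly \<times> ('a poly \<times> 'a poly) \<times> ('a poly \<times> 'a poly)) set)"
    unfolding disjoint_family_on_def
  proof (intro ballI impI)
    fix i j :: "'a poly \<times> 'a poly \<times> ('a poly \<times> 'a poly) \<times> ('a poly \<times> 'a poly)"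
    assume ij: "i \<in> farey_index Q" "j \<in> farey_index Q" "i \<noteq> j"
    obtain r d c1 c2 a1 a2 where i: "i = (r, d, (c1, c2), (a1, a2))"
      by (metis prod.exhaust)
    obtain r' d' c1' c2' a1' a2' where j: "j = (r', d', (c1', c2'), (a1', a2'))"
      by (metis prod.exhaust)
    have False if "(x, y) \<in> farey_box (a1, a2) r Q" "(x, y) \<in> farey_box (a1', a2') r' Q" for x y
      using farey_index_unique[OF ij(1,2)[unfolded i j] that] ij(3) by (simp add: i j)
    then show "(case i of (r, d, c, a) \<Rightarrow> farey_box a r Q) \<inter> (case j of (r, d, c, a) \<Rightarrow> farey_box a r Q) = {}"
      by (auto simp: i j)
  qed
next
  show "(\<Union>(r, d, c, a)\<in>farey_index Q. farey_box a r Q) = (unit_ball \<times> unit_ball :: ('a fls \<times> 'a fls) set)"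
  proof
    show "(\<Union>(r, d, c, a)\<in>farey_index Q. farey_box a r Q) \<subseteq> (unit_ball \<times> unit_ball :: ('a fls \<times> 'a fls) set)"
      by (auto simp: farey_box_def)
    show "unit_ball \<times> unit_ball \<subseteq> (\<Union>(r, d, c, a)\<in>farey_index Q. farey_box a r Q :: ('a fls \<times> 'a fls) set)"
    proof (rule subrelI)
      fix x y :: "'a fls"
      assume "(x, y) \<in> unit_ball \<times> unit_ball"
      then have "absval x < 1" "absval y < 1"
        by (simp_all add: unit_ball_def)
      then obtain r d c1 c2 a1 a2
        where "(r, d, (c1, c2), (a1, a2)) \<in> farey_index Q" "(x, y) \<in> farey_box (a1, a2) r Q"
        by (rule farey_cover[OF less_imp_le[OF assms(2)]])
      then show "(x, y) \<in> (\<Union>(r, d, c, a)\<in>farey_index Q. farey_box a r Q)"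
        by blast
    qed
  qed
qed

end
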